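(* Let $F\in\mathbf N_{-\infty}$ be nonrational with asymptotic coefficients $\{s_j\}_{j\ge0}$, let $J$ be the monic Jacobi matrix associated with $F$, let $\{\mathfrak n_j\}_{j=1}^\infty$ be the normal indices of the sequence $\mathfrak s=\{\mathfrak s_j\}_{j\ge 0}:=\{s_{j+1}\}_{j\ge 0}$, put $\mathfrak n_0=0$ and $\mathfrak k_j:=\mathfrak n_{j+1}-\mathfrak n_j$, $j\in\mathbb Z_+$. Then $J$ admits a factorization $J=LU$, where $$L=\begin{pmatrix} I_{\mathfrak k_0}&0&&\\ L_1&I_{\mathfrak k_1}&0&\\ &L_2&I_{\mathfrak k_2}&\ddots\\ &&\ddots&\ddots\end{pmatrix},\qquad U=\begin{pmatrix} U_0&D_0&&\\ 0&U_1&D_1&\\ &0&U_2&\ddots\\ &&\ddots&\ddots\end{pmatrix}$$ are block lower and block upper triangular matrices in which: $L_{j+1}$ is the $\mathfrak k_{j+1}\times\mathfrak k_j$ matrix whose upper-left entry is a number $l_{j+1}$ and whose other entries are $0$; $U_j=u_0^{(j)}$ if $\mathfrak k_j=1$ and $U_j=\begin{pmatrix}0&1\\ u_0^{(j)}&u_1^{(j)}\end{pmatrix}$ if $\mathfrak k_j=2$; and $D_j$ is the $\mathfrak k_j\times\mathfrak k_{j+1}$ matrix whose lower-left entry is $1$ and whose other entries are $0$. Moreover, this factorization is unique, and $$u_0^{(j)}=-\frac{P_{\mathfrak n_{j+1}}(0)}{P_{\mathfrak n_j}(0)},\qquad u_1^{(j)}=b_{\mathfrak n_j+1},\qquad j\in\mathbb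 Z_+$$ (the second relation for those $j$ with $\mathfrak k_j=2$, where $u_1^{(j)}$ is defined).
   Context: $\lambda\widehat\to\infty$ means that $\lambda\to\infty$ inside a sector $\varepsilon<\arg\lambda<\pi-\varepsilon$, $\varepsilon>0$. $\mathbf N$ is the class of Nevanlinna functions (analytic in $\mathbb C_+$, mapping $\mathbb C_+$ into $\mathbb C_+$). $\mathbf N_{-\infty}$ is the set of $F\in\mathbf N$ for which there are real $s_0,s_1,\dots$ with $F(\lambda)=-\frac{s_0}{\lambda}-\dots-\frac{s_{2n}}{\lambda^{2n+1}}+o(\lambda^{-2n-1})$, $\lambda\widehat\to\infty$, for every $n\in\mathbb Z_+$; equivalently $F(\lambda)=\int_{\mathbb R}\frac{d\sigma(t)}{t-\lambda}$ with a finite measure $\sigma$ on $\mathbb R$ having all moments $s_j=\int t^jd\sigma(t)$ finite. $F$ nonrational means $\operatorname{supp}\sigma$ is infinite. Let $P_j$ be the monic orthogonal polynomials of $\sigma/s_0$; they satisfy $\lambda P_j=P_{j+1}+b_jP_j+c_{j-1}P_{j-1}$, $P_{-1}=0$, $P_0=1$, $b_j\in\mathbb R$, $c_j>0$. The monic Jacobi matrix $J$ associated with $F$ is the semi-infinite tridiagonal matrix with $J_{j,j}=b_j$, $J_{j,j+1}=1$, $J_{j+1,j}=c_j$, $j\in\mathbb Z_+$. The normal indices of a real sequence $\{\mathfrak s_j\}_{j\ge0}$ are the integers $n\ge1$ with $\det(\mathfrak s_{i+k})_{i,k=0}^{n-1}\ne0$, listed increasingly as $\mathfrak n_1<\mathfrak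 n_2<\dots$. In the present situation one always has $\mathfrak k_j\in\{1,2\}$. Uniqueness is understood among factorizations of the displayed form (with the given block sizes $\mathfrak k_j$). *)

theory Defs
  imports
    "HOL-Analysis.Analysis"
    "HOL-Library.Landau_Symbols"
    "HOL-Library.Infinite_Set"
    "HOL-Computational_Algebra.Polynomial"
    "Jordan_Normal_Form.Determinant"
begin

definition upper_half_plane :: "complex set" where
  "upper_half_plane = {z. Im z > 0}"

definition nevanlinna :: "(complex \<Rightarrow> complex) set" where
  "nevanlinna = {F. F holomorphic_on upper_half_plane \<and>
     F ` upper_half_plane \<subseteq> upper_half_plane}"

definition sector_at_infinity :: "real \<Rightarrow> complex filter" where
  "sector_at_infinity \<epsilon> =
     inf at_infinity (principal {z. \<epsilon> < Arg z \<and> Arg z < pi - \<epsilon>})"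

definition asymptotic_coeffs :: "(complex \<Rightarrow> complex) \<Rightarrow> (nat \<Rightarrow> real) \<Rightarrow> bool" where
  "asymptotic_coeffs F s \<longleftrightarrow>
     (\<forall>n. \<forall>\<epsilon>>0.
        (\<lambda>z. F z + (\<Sum>j\<le>2 * n. of_real (s j) / z ^ (j + 1)))
          \<in> o[sector_at_infinity \<epsilon>](\<lambda>z. 1 / z ^ (2 * n + 1)))"

definition nevanlinna_minus_infinity :: "(complex \<Rightarrow> complex) set" where
  "nevanlinna_minus_infinity = {F \<in> nevanlinna. \<exists>s. asymptotic_coeffs F s}"

definition representing_measure :: "(complex \<Rightarrow> complex) \<Rightarrow> real measure \<Rightarrow> bool" where
  "representing_measure F \<sigma> \<longleftrightarrow>
     finite_measure \<sigma> \<and> sets \<sigma> = sets borel \<and>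
     (\<forall>j. integrable \<sigma> (\<lambda>t. t ^ j)) \<and>
     (\<forall>z\<in>upper_half_plane. F z = (\<integral>t. 1 / (of_real t - z) \<partial>\<sigma>))"

definition measure_support :: "real measure \<Rightarrow> real set" where
  "measure_support \<mu> = {x. \<forall>U. open U \<longrightarrow> x \<in> U \<longrightarrow> emeasure \<mu> U > 0}"

definition monic_orthogonal_polys :: "real measure \<Rightarrow> (nat \<Rightarrow> real poly) \<Rightarrow> bool" where
  "monic_orthogonal_polys \<mu> P \<longleftrightarrow>
     (\<forall>j. degree (P j) = j \<and> lead_coeff (P j) = 1) \<and>
     (\<forall>i j. i \<noteq> j \<longrightarrow> (\<integral>t. poly (P i) t * poly (P j) t \<partial>\<mu>) = 0)"

text \<open>The convention \<open>P\<^sub>-\<^sub>1 = 0\<close> makes the case \<open>j = 0\<close> lose its last term.\<close>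

definition jacobi_recurrence ::
    "(nat \<Rightarrow> real poly) \<Rightarrow> (nat \<Rightarrow> real) \<Rightarrow> (nat \<Rightarrow> real) \<Rightarrow> bool" where
  "jacobi_recurrence P b c \<longleftrightarrow>
     (\<forall>j. c j > 0) \<and>
     (\<forall>j. [:0, 1:] * P j = P (j + 1) + Polynomial.smult (b j) (P j) +
            (if j = 0 then 0 else Polynomial.smult (c (j - 1)) (P (j - 1))))"

text \<open>Semi-infinite matrices are functions of two natural indices, finite matrices (blocks)
  are those of \<open>Jordan_Normal_Form\<close>.\<close>

type_synonym infmat = "nat \<Rightarrow> nat \<Rightarrow> real"

definition monic_jacobi_matrix :: "(nat \<Rightarrow> real) \<Rightarrow> (nat \<Rightarrow> real) \<Rightarrow> infmat" where
  "monic_jacobi_matrix b c i k =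
     (if k = i then b i else if k = i + 1 then 1 else if i = k + 1 then c k else 0)"

text \<open>The sum is finite as soon as the rows of the left factor have finite support, which is
  the case for block lower triangular matrices.\<close>

definition infmat_mult :: "infmat \<Rightarrow> infmat \<Rightarrow> infmat" where
  "infmat_mult A B i k = (\<Sum>m | A i m \<noteq> 0. A i m * B m k)"

definition normal_indices :: "(nat \<Rightarrow> real) \<Rightarrow> nat set" where
  "normal_indices s =
     {n. n \<ge> 1 \<and> Determinant.det (Matrix.mat n n (\<lambda>(i, k). s (i + k))) \<noteq> 0}"

text \<open>Only meaningful for all \<open>j\<close> when there are infinitely many normal indices;
  \<open>Infinite_Set.enumerate\<close> lists a set increasingly, starting with argument \<open>0\<close>.\<close>

definition normal_index :: "(nat \<Rightarrow> real) \<Rightarrow> nat \<Rightarrow> nat" where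
  "normal_index s j = (if j = 0 then 0 else Infinite_Set.enumerate (normal_indices s) (j - 1))"

definition block_size :: "(nat \<Rightarrow> nat) \<Rightarrow> nat \<Rightarrow> nat" where
  "block_size \<nn> j = \<nn> (j + 1) - \<nn> j"

text \<open>\<open>A\<close> is the block matrix with blocks \<open>B i j\<close>, where the \<open>j\<close>-th block of rows (and of
  columns) consists of the indices \<open>\<nn> j, \<dots>, \<nn> (j + 1) - 1\<close>.\<close>

definition has_blocks :: "(nat \<Rightarrow> nat) \<Rightarrow> (nat \<Rightarrow> nat \<Rightarrow> real mat) \<Rightarrow> infmat \<Rightarrow> bool" where
  "has_blocks \<nn> B A \<longleftrightarrow>
     (\<forall>i j. B i j \<in> carrier_mat (block_size \<nn> i) (block_size \<nn> j) \<and>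
        (\<forall>p<block_size \<nn> i. \<forall>q<block_size \<nn> j. A (\<nn> i + p) (\<nn> j + q) = B i j $$ (p, q)))"

definition L_block :: "(nat \<Rightarrow> nat) \<Rightarrow> (nat \<Rightarrow> real) \<Rightarrow> nat \<Rightarrow> nat \<Rightarrow> real mat" where
  "L_block \<nn> l i j =
     (if i = j then 1\<^sub>m (block_size \<nn> j)
      else if i = j + 1 then
        Matrix.mat (block_size \<nn> i) (block_size \<nn> j)
          (\<lambda>(p, q). if p = 0 \<and> q = 0 then l i else 0)
      else 0\<^sub>m (block_size \<nn> i) (block_size \<nn> j))"

definition U_block ::
    "(nat \<Rightarrow> nat) \<Rightarrow> (nat \<Rightarrow> real) \<Rightarrow> (nat \<Rightarrow> real) \<Rightarrow> nat \<Rightarrow> nat \<Rightarrow> real mat" where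
  "U_block \<nn> u\<^sub>0 u\<^sub>1 i j =
     (if i = j then
        (if block_size \<nn> j = 1 then mat_of_rows_list 1 [[u\<^sub>0 j]]
         else mat_of_rows_list 2 [[0, 1], [u\<^sub>0 j, u\<^sub>1 j]])
      else if j = i + 1 then
        Matrix.mat (block_size \<nn> i) (block_size \<nn> j)
          (\<lambda>(p, q). if p = block_size \<nn> i - 1 \<and> q = 0 then 1 else 0)
      else 0\<^sub>m (block_size \<nn> i) (block_size \<nn> j))"

text \<open>The values \<open>l 0\<close>, and \<open>u\<^sub>1 j\<close> for blocks of size 1, are not used.\<close>

definition LU_factorization ::
    "(nat \<Rightarrow> nat) \<Rightarrow> infmat \<Rightarrow> (nat \<Rightarrow> real) \<Rightarrow> (nat \<Rightarrow> real) \<Rightarrow> (nat \<Rightarrow> real) \<Rightarrow>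
     infmat \<Rightarrow> infmat \<Rightarrow> bool" where
  "LU_factorization \<nn> J l u\<^sub>0 u\<^sub>1 L U \<longleftrightarrow>
     has_blocks \<nn> (L_block \<nn> l) L \<and> has_blocks \<nn> (U_block \<nn> u\<^sub>0 u\<^sub>1) U \<and>
     J = infmat_mult L U"

end

theory Submission
  imports Defs
begin

text \<open>
  Along the imaginary axis an asymptotic expansion determines its coefficients, so the \<open>s\<^sub>j\<close> are
  the moments of \<open>\<sigma>\<close>. A kernel vector of the shifted Hankel matrix \<open>(s\<^sub>i\<^sub>+\<^sub>k\<^sub>+\<^sub>1)\<close> of size \<open>n\<close> is a
  polynomial \<open>q\<close> of degree less than \<open>n\<close> such that \<open>t q\<close> is orthogonal to all polynomials of degree
  less than \<open>n\<close>, that is, such that \<open>t q\<close> is a multiple of \<open>P\<^sub>n\<close>. Hence \<open>n\<close> is a normal index iff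
  \<open>P\<^sub>n(0) \<noteq> 0\<close>. By the recurrence no two consecutive \<open>P\<^sub>n(0)\<close> vanish, which gives the block sizes.
  Comparing \<open>J\<close> with \<open>LU\<close> entry by entry then yields a recursion that determines the unknowns block
  by block, and the recurrence evaluated at 0 shows that the stated values solve it.
\<close>

section \<open>Asymptotic expansions and moments\<close>

lemma cauchy_kernel_expansion:
  fixes w z :: complex
  assumes "z \<noteq> 0" "w \<noteq> z"
  shows "1 / (w - z) + (\<Sum>j\<le>N. w ^ j / z ^ (j + 1)) = w ^ (N + 1) / (z ^ (N + 1) * (w - z))"
proof (induction N)
  case 0
  then show ?case using assms by (simp add: field_simps)
next
  case (Suc N)
  have "1 / (w - z) + (\<Sum>j\<le>Suc N. w ^ j / z ^ (j + 1))
      = w ^ (N + 1) / (z ^ (N + 1) * (w - z)) + w ^ Suc N / z ^ (Suc N + 1)"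
    using Suc.IH by simp
  also have "\<dots> = w ^ (Suc N + 1) / (z ^ (Suc N + 1) * (w - z))"
    using assms by (simp add: field_simps)
  finally show ?case .
qed

lemma cauchy_transform_expansion:
  fixes \<sigma> :: "real measure"
  assumes fin: "finite_measure \<sigma>" and sets: "sets \<sigma> = sets borel"
    and int: "\<And>j. integrable \<sigma> (\<lambda>t. t ^ j)"
    and z: "Im z > 0"
  shows "norm ((\<integral>t. 1 / (of_real t - z) \<partial>\<sigma>) + (\<Sum>j\<le>N. of_real (\<integral>t. t ^ j \<partial>\<sigma>) / z ^ (j + 1)))
           \<le> (\<integral>t. \<bar>t\<bar> ^ (N + 1) \<partial>\<sigma>) / (norm z ^ (N + 1) * Im z)"
proof -
  have [measurable]: "(\<lambda>t. complex_of_real t) \<in> borel_measurable borel"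
    by simp
  have ne: "z \<noteq> 0" "\<And>t. of_real t \<noteq> z" using z by auto
  have ge: "Im z \<le> norm (of_real t - z)" for t
    using abs_Im_le_cmod[of "of_real t - z"] z by simp
  have i0: "integrable \<sigma> (\<lambda>t. 1 / (complex_of_real t - z))"
  proof (rule finite_measure.integrable_const_bound[OF fin, of _ "1 / Im z"])
    show "AE t in \<sigma>. norm (1 / (complex_of_real t - z)) \<le> 1 / Im z"
      using z ge by (intro AE_I2) (auto simp: norm_divide intro!: divide_left_mono mult_pos_pos order.strict_trans2[OF z ge])
  next
    have "(\<lambda>t. 1 / (complex_of_real t - z)) \<in> borel_measurable borel" by measurable
    thus "(\<lambda>t. 1 / (complex_of_real t - z)) \<in> borel_measurable \<sigma>"
      by (simp add: measurable_cong_sets[OF sets refl])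
  qed
  have ij: "integrable \<sigma> (\<lambda>t. complex_of_real (t ^ j) / z ^ (j + 1))" for j
    using int[of j] by (intro integrable_divide integrable_of_real)
  have eq: "(\<integral>t. 1 / (of_real t - z) \<partial>\<sigma>) + (\<Sum>j\<le>N. of_real (\<integral>t. t ^ j \<partial>\<sigma>) / z ^ (j + 1))
      = (\<integral>t. 1 / (of_real t - z) + (\<Sum>j\<le>N. of_real (t ^ j) / z ^ (j + 1)) \<partial>\<sigma>)"
    using i0 ij int by (subst Bochner_Integration.integral_add)
      (auto simp: Bochner_Integration.integral_sum simp del: of_real_power)
  have intabs: "integrable \<sigma> (\<lambda>t. \<bar>t\<bar> ^ (N + 1))"
    using integrable_abs[OF int[of "N + 1"]] by (simp only: power_abs)
  have bound: "norm (1 / (of_real t - z) + (\<Sum>j\<le>N. of_real (t ^ j) / z ^ (j + 1)))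
      \<le> \<bar>t\<bar> ^ (N + 1) / (norm z ^ (N + 1) * Im z)" for t
  proof -
    have "norm (1 / (of_real t - z) + (\<Sum>j\<le>N. of_real (t ^ j) / z ^ (j + 1)))
       = \<bar>t\<bar> ^ (N + 1) / (norm z ^ (N + 1) * norm (of_real t - z))"
      using cauchy_kernel_expansion[OF ne(1) ne(2)[of t], of N]
      by (simp add: norm_divide norm_mult norm_power del: power_Suc)
    also have "\<dots> \<le> \<bar>t\<bar> ^ (N + 1) / (norm z ^ (N + 1) * Im z)"
      using ne(1) z ge[of t] order.strict_trans2[OF z ge[of t]]
      by (intro divide_left_mono mult_left_mono mult_pos_pos) auto
    finally show ?thesis .
  qed
  have "norm (\<integral>t. 1 / (of_real t - z) + (\<Sum>j\<le>N. of_real (t ^ j) / z ^ (j + 1)) \<partial>\<sigma>)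
      \<le> (\<integral>t. norm (1 / (of_real t - z) + (\<Sum>j\<le>N. of_real (t ^ j) / z ^ (j + 1))) \<partial>\<sigma>)"
    by (rule integral_norm_bound)
  also have "\<dots> \<le> (\<integral>t. \<bar>t\<bar> ^ (N + 1) / (norm z ^ (N + 1) * Im z) \<partial>\<sigma>)"
    using i0 ij intabs bound
    by (intro integral_mono integrable_norm Bochner_Integration.integrable_add
        Bochner_Integration.integrable_sum integrable_divide[OF intabs] i0 ij bound)
  also have "\<dots> = (\<integral>t. \<bar>t\<bar> ^ (N + 1) \<partial>\<sigma>) / (norm z ^ (N + 1) * Im z)"
    by simp
  finally show ?thesis unfolding eq .
qed

lemma tendsto_0_divide_imaginary:
  assumes "(f \<longlongrightarrow> a) at_top"
  shows "((\<lambda>y. f y / (\<i> * complex_of_real y)) \<longlongrightarrow> 0) at_top"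
proof -
  have "((\<lambda>y. f y * (- \<i>) * complex_of_real (inverse y)) \<longlongrightarrow> a * (- \<i>) * complex_of_real 0) at_top"
    by (intro tendsto_intros assms tendsto_inverse_0_at_top filterlim_ident)
  moreover have "f y * (- \<i>) * complex_of_real (inverse y) = f y / (\<i> * complex_of_real y)" for y
    by (cases "y = 0") (auto simp: field_simps)
  ultimately show ?thesis by simp
qed

lemma poly_tendsto_0_imaginary_axis:
  fixes p :: "complex poly"
  assumes "((\<lambda>y. poly p (\<i> * complex_of_real y)) \<longlongrightarrow> 0) at_top"
  shows "p = 0"
  using assms
proof (induction p)
  case 0
  then show ?case by simp
next
  case (pCons a p)
  have "((\<lambda>y. poly (pCons a p) (\<i> * of_real y) - a) \<longlongrightarrow> 0 - a) at_top"
    by (intro tendsto_intros pCons.prems)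
  hence "((\<lambda>y. (\<i> * of_real y) * poly p (\<i> * complex_of_real y)) \<longlongrightarrow> - a) at_top"
    by simp
  from tendsto_0_divide_imaginary[OF this]
  have "((\<lambda>y. (\<i> * of_real y) * poly p (\<i> * of_real y) / (\<i> * of_real y)) \<longlongrightarrow> 0) at_top" .
  hence "((\<lambda>y. poly p (\<i> * complex_of_real y)) \<longlongrightarrow> 0) at_top"
    by (rule Lim_transform_eventually)
      (use eventually_gt_at_top[of 0] in eventually_elim, simp)
  hence "p = 0" by (rule pCons.IH)
  with pCons.prems show ?case by (auto simp: tendsto_const_iff)
qed

lemma filterlim_imaginary_sector:
  "filterlim (\<lambda>y. \<i> * complex_of_real y) (sector_at_infinity 1) at_top"
proof -
  have "filterlim (\<lambda>y. \<i> * complex_of_real y) at_infinity at_top"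
    by (rule filterlim_norm_at_top_imp_at_infinity)
      (rule filterlim_at_top_mono[OF filterlim_ident], simp add: norm_mult abs_ge_self)
  moreover have "\<forall>\<^sub>F y in at_top. 1 < Arg (\<i> * complex_of_real y) \<and> Arg (\<i> * complex_of_real y) < pi - 1"
    using eventually_gt_at_top[of 0]
    by eventually_elim (use pi_gt3 in simp)
  ultimately show ?thesis
    by (auto simp: sector_at_infinity_def filterlim_inf filterlim_principal)
qed

lemma asymptotic_coeffs_eq_moments:
  assumes asy: "asymptotic_coeffs F s" and rep: "representing_measure F \<sigma>"
  shows "s j = (\<integral>t. t ^ j \<partial>\<sigma>)"
proof -
  define m where "m j = (\<integral>t. t ^ j \<partial>\<sigma>)" for j
  define C where "C = (\<integral>t. \<bar>t\<bar> ^ (2 * j + 1) \<partial>\<sigma>)"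
  define z where "z y = \<i> * complex_of_real y" for y
  define p where "p = (\<Sum>i\<le>2 * j. monom (complex_of_real (s i - m i)) (2 * j - i))"
  have lim1: "((\<lambda>y. (F (z y) + (\<Sum>i\<le>2 * j. of_real (s i) / z y ^ (i + 1))) * z y ^ (2 * j + 1)) \<longlongrightarrow> 0) at_top"
  proof -
    have "(\<lambda>z. F z + (\<Sum>i\<le>2 * j. of_real (s i) / z ^ (i + 1))) \<in> o[sector_at_infinity 1](\<lambda>z. 1 / z ^ (2 * j + 1))"
      using asy by (auto simp: asymptotic_coeffs_def)
    from landau_o.small.compose[OF this filterlim_imaginary_sector]
    have "((\<lambda>y. (F (z y) + (\<Sum>i\<le>2 * j. of_real (s i) / z y ^ (i + 1))) / (1 / z y ^ (2 * j + 1))) \<longlongrightarrow> 0) at_top"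
      unfolding z_def by (rule smalloD_tendsto)
    thus ?thesis by simp
  qed
  have lim2: "((\<lambda>y. (F (z y) + (\<Sum>i\<le>2 * j. of_real (m i) / z y ^ (i + 1))) * z y ^ (2 * j + 1)) \<longlongrightarrow> 0) at_top"
  proof (rule Lim_null_comparison)
    show "\<forall>\<^sub>F y in at_top. norm ((F (z y) + (\<Sum>i\<le>2 * j. of_real (m i) / z y ^ (i + 1))) * z y ^ (2 * j + 1))
       \<le> C * inverse y"
      using eventually_gt_at_top[of 0]
    proof eventually_elim
      case (elim y)
      hence y: "norm (z y) = y" "Im (z y) = y" by (simp_all add: z_def norm_mult)
      have "norm (F (z y) + (\<Sum>i\<le>2 * j. of_real (m i) / z y ^ (i + 1)))
          \<le> C / (norm (z y) ^ (2 * j + 1) * Im (z y))"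
        using cauchy_transform_expansion[of \<sigma> "z y" "2 * j"] rep elim
        unfolding m_def C_def representing_measure_def upper_half_plane_def z_def by simp
      hence "norm (F (z y) + (\<Sum>i\<le>2 * j. of_real (m i) / z y ^ (i + 1))) * y ^ (2 * j + 1)
          \<le> C / (y ^ (2 * j + 1) * y) * y ^ (2 * j + 1)"
        using elim unfolding y by (intro mult_right_mono) auto
      also have "\<dots> = C * inverse y" using elim by (simp add: field_simps)
      finally show ?case unfolding norm_mult norm_power y .
    qed
    have "((\<lambda>y. C * inverse y) \<longlongrightarrow> C * 0) at_top"
      by (intro tendsto_intros tendsto_inverse_0_at_top filterlim_ident)
    thus "((\<lambda>y. C * inverse y) \<longlongrightarrow> 0) at_top" by simp
  qed
  have "((\<lambda>y. poly p (z y)) \<longlongrightarrow> 0) at_top"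
  proof (rule Lim_transform_eventually)
    show "((\<lambda>y. (F (z y) + (\<Sum>i\<le>2 * j. of_real (s i) / z y ^ (i + 1))) * z y ^ (2 * j + 1)
       - (F (z y) + (\<Sum>i\<le>2 * j. of_real (m i) / z y ^ (i + 1))) * z y ^ (2 * j + 1)) \<longlongrightarrow> 0) at_top"
      using tendsto_diff[OF lim1 lim2] by simp
    show "\<forall>\<^sub>F y in at_top. (F (z y) + (\<Sum>i\<le>2 * j. of_real (s i) / z y ^ (i + 1))) * z y ^ (2 * j + 1)
       - (F (z y) + (\<Sum>i\<le>2 * j. of_real (m i) / z y ^ (i + 1))) * z y ^ (2 * j + 1) = poly p (z y)"
      using eventually_gt_at_top[of 0]
    proof eventually_elim
      case (elim y)
      hence nz: "z y \<noteq> 0" by (simp add: z_def)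
      have *: "x / z y ^ (i + 1) * z y ^ (2 * j + 1) = x * z y ^ (2 * j - i)" if "i \<le> 2 * j" for i x
        using that nz by (simp add: power_diff field_simps)
      have "(F (z y) + (\<Sum>i\<le>2 * j. of_real (s i) / z y ^ (i + 1))) * z y ^ (2 * j + 1)
       - (F (z y) + (\<Sum>i\<le>2 * j. of_real (m i) / z y ^ (i + 1))) * z y ^ (2 * j + 1)
       = (\<Sum>i\<le>2 * j. of_real (s i - m i) / z y ^ (i + 1) * z y ^ (2 * j + 1))"
        by (simp add: algebra_simps sum_distrib_left sum_distrib_right sum_subtractf diff_divide_distrib)
      also have "\<dots> = (\<Sum>i\<le>2 * j. of_real (s i - m i) * z y ^ (2 * j - i))"
        by (rule sum.cong[OF refl], rule *) simp
      also have "\<dots> = poly p (z y)"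
        by (simp add: p_def poly_sum poly_monom)
      finally show ?case .
    qed
  qed
  hence "p = 0" unfolding z_def by (rule poly_tendsto_0_imaginary_axis)
  moreover have "coeff p j = complex_of_real (s j - m j)"
  proof -
    have "coeff p j = (\<Sum>i\<le>2 * j. if i = j then complex_of_real (s i - m i) else 0)"
      unfolding p_def coeff_sum coeff_monom by (rule sum.cong) auto
    thus ?thesis by simp
  qed
  ultimately show ?thesis by (simp add: m_def)
qed

section \<open>Orthogonal polynomials and shifted Hankel determinants\<close>

lemma infinite_support_imp_poly_eq_0:
  fixes \<sigma> :: "real measure" and q :: "real poly"
  assumes sets: "sets \<sigma> = sets borel" and int: "integrable \<sigma> (\<lambda>t. poly (q * q) t)"
    and supp: "infinite (measure_support \<sigma>)"
    and 0: "(\<integral>t. poly (q * q) t \<partial>\<sigma>) = 0"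
  shows "q = 0"
proof (rule ccontr)
  assume q: "q \<noteq> 0"
  have "AE t in \<sigma>. poly (q * q) t = 0"
    using integral_nonneg_eq_0_iff_AE[OF int] 0 by simp
  hence ae: "AE t in \<sigma>. poly q t = 0" by simp
  have op: "open {t. poly q t \<noteq> 0}"
    by (intro open_Collect_neq continuous_intros)
  hence "{t. poly q t \<noteq> 0} \<in> sets \<sigma>" by (simp add: sets)
  with ae have "emeasure \<sigma> {t. poly q t \<noteq> 0} = 0"
    using sets_eq_imp_space_eq[OF sets] by (subst (asm) AE_iff_measurable[OF _ refl]) simp_all
  with op have "measure_support \<sigma> \<subseteq> {t. poly q t = 0}"
    by (force simp: measure_support_def)
  with poly_roots_finite[OF q] supp show False
    using finite_subset by blast
qed

lemma integrable_poly:
  fixes \<sigma> :: "real measure"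
  assumes "\<And>j. integrable \<sigma> (\<lambda>t. t ^ j)"
  shows "integrable \<sigma> (\<lambda>t. poly p t)"
  unfolding poly_altdef using assms by (intro Bochner_Integration.integrable_sum integrable_mult_right)

lemma scale_measure_eq_density:
  "scale_measure r M = density M (\<lambda>_. r)"
  by (rule measure_eqI) (auto simp: emeasure_density_const)

lemma integral_scale_measure:
  fixes f :: "'a \<Rightarrow> real"
  assumes "f \<in> borel_measurable M" "r \<ge> 0"
  shows "(\<integral>x. f x \<partial>(scale_measure (ennreal r) M)) = r * (\<integral>x. f x \<partial>M)"
  using assms by (simp add: scale_measure_eq_density integral_real_density)

locale definite_functional =
  fixes I :: "real poly \<Rightarrow> real"
  assumes add: "I (p + q) = I p + I q"
    and smult: "I (Polynomial.smult a p) = a * I p"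
    and definite: "I (p * p) = 0 \<Longrightarrow> p = 0"
begin

lemma zero: "I 0 = 0" using smult[of 0 0] by simp

lemma sum: "I (\<Sum>i\<in>A. f i) = (\<Sum>i\<in>A. I (f i))"
  by (induction A rule: infinite_finite_induct) (auto simp: zero add)

lemma hankel_mult_vec:
  assumes v: "v \<in> carrier_vec n" and i: "i < n"
  shows "vec_index (Matrix.mat n n (\<lambda>(i, k). I (monom 1 (i + k + 1))) *\<^sub>v v) i
    = I (monom 1 i * (pCons 0 (\<Sum>k<n. monom (vec_index v k) k)))"
proof -
  have "monom 1 i * pCons 0 (\<Sum>k<n. monom (vec_index v k) k)
      = (\<Sum>k<n. Polynomial.smult (vec_index v k) (monom 1 (i + k + 1)))"
  proof -
    have "pCons 0 (\<Sum>k<n. monom (vec_index v k) k) = monom 1 1 * (\<Sum>k<n. monom (vec_index v k) k)"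
      by (simp add: monom_altdef)
    thus ?thesis
      by (simp add: sum_distrib_left mult_monom smult_monom add.commute mult.assoc[symmetric] add.left_commute)
  qed
  thus ?thesis using v i
    by (simp add: scalar_prod_def sum smult mult.commute lessThan_atLeast0)
qed

context
  fixes P :: "nat \<Rightarrow> real poly"
  assumes degree_P: "\<And>j. degree (P j) = j" and monic_P: "\<And>j. lead_coeff (P j) = 1"
    and orthogonal_P: "\<And>i j. i \<noteq> j \<Longrightarrow> I (P i * P j) = 0"
begin

lemma orthogonal_lower_degree:
  assumes "q = 0 \<or> degree q < n"
  shows "I (q * P n) = 0"
  using assms
proof (induction "degree q" arbitrary: q rule: less_induct)
  case less
  show ?case
  proof (cases "q = 0")
    case True
    thus ?thesis by (simp add: zero)
  next
    case False
    define r where "r = q - Polynomial.smult (lead_coeff q) (P (degree q))"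
    have coeff_r: "coeff r (degree q) = 0"
      using monic_P[of "degree q"] by (simp add: r_def degree_P)
    have "degree r \<le> degree q"
      unfolding r_def by (intro degree_diff_le) (auto simp: degree_P)
    hence r: "r = 0 \<or> degree r < degree q"
      using coeff_r le_neq_implies_less leading_coeff_0_iff by metis
    have "I (r * P n) = 0"
      using r less.hyps[of r] less.prems False by (auto simp: zero)
    moreover have "I (P (degree q) * P n) = 0"
      using less.prems False by (intro orthogonal_P) auto
    moreover have "q * P n = r * P n + Polynomial.smult (lead_coeff q) (P (degree q) * P n)"
      by (simp add: r_def algebra_simps)
    ultimately show ?thesis by (simp add: add smult)
  qed
qed

lemma orthogonal_unique:
  assumes "degree q \<le> n" and orth: "\<And>i. i < n \<Longrightarrow> I (monom 1 i * q) = 0"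
  shows "q = Polynomial.smult (coeff q n) (P n)"
proof -
  define r where "r = q - Polynomial.smult (coeff q n) (P n)"
  have coeff_r: "coeff r n = 0"
    using monic_P[of n] by (simp add: r_def degree_P)
  have "degree r \<le> n"
    unfolding r_def using assms(1) by (intro degree_diff_le) (auto simp: degree_P)
  hence r: "r = 0 \<or> degree r < n"
    using coeff_r le_neq_implies_less leading_coeff_0_iff by metis
  have "I (r * q) = 0"
  proof (cases "r = 0")
    case False
    have "r * q = (\<Sum>i\<le>degree r. Polynomial.smult (coeff r i) (monom 1 i * q))"
      by (subst poly_as_sum_of_monoms[symmetric])
        (simp add: sum_distrib_right smult_monom flip: mult_smult_left)
    moreover have "I (monom 1 i * q) = 0" if "i \<le> degree r" for i
      using that r False by (intro orth) auto
    ultimately show ?thesis by (simp add: sum smult)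
  qed (simp add: zero)
  moreover have "r * r = r * (q - Polynomial.smult (coeff q n) (P n))"
    by (simp add: r_def)
  hence "r * r = r * q + Polynomial.smult (- coeff q n) (r * P n)"
    by (simp add: right_diff_distrib)
  ultimately have "I (r * r) = 0"
    using orthogonal_lower_degree[OF r] by (simp only: add smult)
  from definite[OF this] show ?thesis by (simp add: r_def)
qed

lemma shifted_hankel_det_eq_0_iff:
  assumes "n \<ge> 1"
  shows "Determinant.det (Matrix.mat n n (\<lambda>(i, k). I (monom 1 (i + k + 1)))) = 0 \<longleftrightarrow> poly (P n) 0 = 0"
    (is "Determinant.det ?H = 0 \<longleftrightarrow> _")
proof -
  have H: "?H \<in> carrier_mat n n" by simp
  have "(\<exists>v. v \<in> carrier_vec n \<and> v \<noteq> 0\<^sub>v n \<and> ?H *\<^sub>v v = 0\<^sub>v n) \<longleftrightarrow> poly (P n) 0 = 0"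
  proof
    assume "\<exists>v. v \<in> carrier_vec n \<and> v \<noteq> 0\<^sub>v n \<and> ?H *\<^sub>v v = 0\<^sub>v n"
    then obtain v where v: "v \<in> carrier_vec n" "v \<noteq> 0\<^sub>v n" "?H *\<^sub>v v = 0\<^sub>v n" by blast
    define q where "q = (\<Sum>k<n. monom (vec_index v k) k)"
    have cq: "coeff q k = (if k < n then vec_index v k else 0)" for k
      unfolding q_def coeff_sum coeff_monom by (simp add: sum.delta)
    have "q \<noteq> 0"
    proof
      assume "q = 0"
      hence "vec_index v i = 0" if "i < n" for i using cq[of i] that by simp
      hence "v = 0\<^sub>v n" using v(1) by (intro eq_vecI) auto
      with v(2) show False by simp
    qed
    have "degree (pCons 0 q) \<le> n"
      using cq assms by (intro degree_le) (auto simp: coeff_pCons split: nat.splits)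
    moreover have "I (monom 1 i * pCons 0 q) = 0" if "i < n" for i
      unfolding q_def hankel_mult_vec[OF v(1) that, symmetric] v(3) using that by simp
    ultimately have *: "pCons 0 q = Polynomial.smult (coeff (pCons 0 q) n) (P n)"
      by (rule orthogonal_unique)
    hence "coeff (pCons 0 q) n * poly (P n) 0 = 0"
      by (metis poly_pCons poly_smult mult_zero_left add.right_neutral)
    moreover have "coeff (pCons 0 q) n \<noteq> 0" using * \<open>q \<noteq> 0\<close>
      by (metis pCons_eq_0_iff smult_0_left)
    ultimately show "poly (P n) 0 = 0" by simp
  next
    assume "poly (P n) 0 = 0"
    then obtain q where q: "P n = pCons 0 q"
      by (metis poly_0_coeff_0 pCons_cases coeff_pCons_0)
    have "P n \<noteq> 0" using monic_P[of n] by auto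
    hence q0: "q \<noteq> 0" using q by auto
    hence dq: "degree q < n" using degree_P[of n] q by simp
    define v where "v = Matrix.vec n (coeff q)"
    have v: "v \<in> carrier_vec n" by (simp add: v_def)
    have qv: "q = (\<Sum>k<n. monom (vec_index v k) k)"
    proof (rule poly_eqI)
      fix k show "coeff q k = coeff (\<Sum>k<n. monom (vec_index v k) k) k"
        using dq by (auto simp: coeff_sum coeff_monom v_def coeff_eq_0 sum.delta)
    qed
    have "v \<noteq> 0\<^sub>v n"
    proof
      assume "v = 0\<^sub>v n"
      hence "q = 0" by (subst qv) simp
      with q0 show False by simp
    qed
    moreover have "?H *\<^sub>v v = 0\<^sub>v n"
    proof (rule eq_vecI)
      fix i assume "i < dim_vec (0\<^sub>v n)"
      hence i: "i < n" by simp
      have "vec_index (?H *\<^sub>v v) i = I (monom 1 i * P n)"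
        unfolding q hankel_mult_vec[OF v i] using qv by simp
      also have "\<dots> = 0" using i by (intro orthogonal_lower_degree) (simp add: degree_monom_eq)
      finally show "vec_index (?H *\<^sub>v v) i = vec_index (0\<^sub>v n) i" using i by simp
    qed simp
    ultimately show "\<exists>v. v \<in> carrier_vec n \<and> v \<noteq> 0\<^sub>v n \<and> ?H *\<^sub>v v = 0\<^sub>v n" using v by blast
  qed
  thus ?thesis using det_0_iff_vec_prod_zero_field[OF H] by simp
qed

end

end

section \<open>Block factorizations of monic Jacobi matrices\<close>

locale block_partition =
  fixes \<nn> :: "nat \<Rightarrow> nat"
  assumes start: "\<nn> 0 = 0" and size: "block_size \<nn> j \<in> {1, 2}"
begin

lemma next_block: "\<nn> (Suc j) = \<nn> j + block_size \<nn> j"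
  using size[of j] by (auto simp: block_size_def)

lemma block_exists: "\<exists>j p. p < block_size \<nn> j \<and> i = \<nn> j + p"
proof (induction i)
  case 0
  have "0 < block_size \<nn> 0" using size[of 0] by auto
  thus ?case using start by (intro exI[of _ 0]) auto
next
  case (Suc i)
  then obtain j p where jp: "p < block_size \<nn> j" "i = \<nn> j + p" by blast
  show ?case
  proof (cases "Suc p < block_size \<nn> j")
    case True
    thus ?thesis using jp by (intro exI[of _ j] exI[of _ "Suc p"]) auto
  next
    case False
    hence "Suc i = \<nn> (Suc j) + 0" using jp next_block[of j] by simp
    moreover have "0 < block_size \<nn> (Suc j)" using size[of "Suc j"] by auto
    ultimately show ?thesis by blast
  qed
qed

lemma block_cases:
  obtains j p where "p < block_size \<nn> j" "i = \<nn> j + p"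
  using block_exists[of i] by blast

lemma strict_mono: "strict_mono \<nn>"
  unfolding strict_mono_Suc_iff
proof
  show "\<nn> j < \<nn> (Suc j)" for j using next_block[of j] size[of j] by auto
qed

lemma less_iff: "\<nn> i < \<nn> j \<longleftrightarrow> i < j"
  using strict_mono by (simp add: strict_mono_less)

lemma block_unique:
  assumes "p < block_size \<nn> i" "q < block_size \<nn> j" "\<nn> i + p = \<nn> j + q"
  shows "i = j \<and> p = q"
proof -
  have "\<nn> i < \<nn> (Suc j)" "\<nn> j < \<nn> (Suc i)"
    using assms next_block[of i] next_block[of j] by linarith+
  hence "i = j" unfolding less_iff by simp
  thus ?thesis using assms by simp
qed

lemma has_blocks_unique:
  assumes "has_blocks \<nn> B A" "has_blocks \<nn> B A'"
  shows "A = A'"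
proof (intro ext)
  fix i k
  obtain a p where a: "p < block_size \<nn> a" "i = \<nn> a + p" by (rule block_cases)
  obtain b q where b: "q < block_size \<nn> b" "k = \<nn> b + q" by (rule block_cases)
  show "A i k = A' i k"
    using assms a b by (simp add: has_blocks_def)
qed

lemma has_blocks_exists:
  assumes "\<And>i j. B i j \<in> carrier_mat (block_size \<nn> i) (block_size \<nn> j)"
  shows "\<exists>A. has_blocks \<nn> B A"
proof -
  define pos where "pos i = (SOME (j, p). p < block_size \<nn> j \<and> i = \<nn> j + p)" for i
  have pos: "pos (\<nn> j + p) = (j, p)" if "p < block_size \<nn> j" for j p
  proof -
    have "\<exists>x. (\<lambda>(j', p'). p' < block_size \<nn> j' \<and> \<nn> j + p = \<nn> j' + p') x"
      using that by auto
    from someI_ex[OF this] show ?thesis unfolding pos_def[symmetric]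
      using block_unique[OF that] by (auto split: prod.splits)
  qed
  show ?thesis
    by (rule exI[of _ "\<lambda>i k. B (fst (pos i)) (fst (pos k)) $$ (snd (pos i), snd (pos k))"])
      (simp add: has_blocks_def pos assms)
qed

lemma L_block_carrier: "L_block \<nn> l i j \<in> carrier_mat (block_size \<nn> i) (block_size \<nn> j)"
  by (auto simp: L_block_def)

lemma U_block_carrier: "U_block \<nn> u\<^sub>0 u\<^sub>1 i j \<in> carrier_mat (block_size \<nn> i) (block_size \<nn> j)"
  using size[of j] by (auto simp: U_block_def mat_of_rows_list_def)

lemma L_entry:
  assumes "has_blocks \<nn> (L_block \<nn> l) L" and p: "p < block_size \<nn> j"
  shows "L (\<nn> j + p) m =
    (if m = \<nn> j + p then 1 else if 0 < j \<and> p = 0 \<and> m = \<nn> (j - 1) then l j else 0)"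
proof -
  obtain i q where q: "q < block_size \<nn> i" "m = \<nn> i + q" by (rule block_cases)
  have *: "m = \<nn> j + p \<longleftrightarrow> i = j \<and> q = p"
    using block_unique[OF q(1) p] q(2) by auto
  have "0 < block_size \<nn> (j - 1)" using size[of "j - 1"] by auto
  hence **: "m = \<nn> (j - 1) \<longleftrightarrow> i = j - 1 \<and> q = 0"
    using block_unique[OF q(1), of 0 "j - 1"] q(2) by auto
  have "L (\<nn> j + p) m = L_block \<nn> l j i $$ (p, q)"
    using assms q by (simp add: has_blocks_def)
  thus ?thesis unfolding * ** using p q(1)
    by (auto simp: L_block_def one_mat_def)
qed

lemma U_entry:
  assumes "has_blocks \<nn> (U_block \<nn> u\<^sub>0 u\<^sub>1) U" and p: "p < block_size \<nn> j"
  shows "U (\<nn> j + p) m =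
    (if m = \<nn> j + p + 1 then 1
     else if p + 1 < block_size \<nn> j then 0
     else if m = \<nn> j then u\<^sub>0 j
     else if m = \<nn> j + p then u\<^sub>1 j else 0)"
proof -
  obtain i q where q: "q < block_size \<nn> i" "m = \<nn> i + q" by (rule block_cases)
  have U: "U (\<nn> j + p) m = U_block \<nn> u\<^sub>0 u\<^sub>1 j i $$ (p, q)"
    using assms q by (simp add: has_blocks_def)
  have z: "0 < block_size \<nn> k" for k using size[of k] by auto
  have *: "m = \<nn> k + r \<longleftrightarrow> i = k \<and> q = r" if "r < block_size \<nn> k" for k r
    using block_unique[OF q(1) that] q(2) by auto
  have a: "m = \<nn> j \<longleftrightarrow> i = j \<and> q = 0" using *[of 0 j] z[of j] by simp
  have b: "m = \<nn> (Suc j) \<longleftrightarrow> i = Suc j \<and> q = 0" using *[of 0 "Suc j"] z[of "Suc j"] by simp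
  have c: "m = \<nn> j + p \<longleftrightarrow> i = j \<and> q = p" using *[of p j] p by simp
  show ?thesis
  proof (cases "p + 1 < block_size \<nn> j")
    case True
    hence s: "block_size \<nn> j = 2" "p = 0" using size[of j] by auto
    have d: "m = \<nn> j + p + 1 \<longleftrightarrow> i = j \<and> q = 1" using *[of 1 j] s by simp
    show ?thesis unfolding U d using True s q
      by (auto simp: U_block_def mat_of_rows_list_def less_2_cases_iff)
  next
    case False
    hence s: "p = block_size \<nn> j - 1" "\<nn> j + p + 1 = \<nn> (Suc j)"
      using p next_block[of j] by auto
    show ?thesis unfolding U s(2) a b c using False s(1) p q(1) size[of j]
      by (auto simp: U_block_def mat_of_rows_list_def less_2_cases_iff)
  qed
qed

lemma LU_row:
  assumes L: "has_blocks \<nn> (L_block \<nn> l) L" and p: "p < block_size \<nn> j"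
  shows "infmat_mult L U (\<nn> j + p) m =
    U (\<nn> j + p) m + (if 0 < j \<and> p = 0 then l j * U (\<nn> (j - 1)) m else 0)"
proof -
  have ne: "\<nn> (j - 1) \<noteq> \<nn> j + p" if "0 < j"
    using less_iff[of "j - 1" j] that by simp
  have "infmat_mult L U (\<nn> j + p) m
      = (\<Sum>k\<in>(if 0 < j \<and> p = 0 then {\<nn> j + p, \<nn> (j - 1)} else {\<nn> j + p}). L (\<nn> j + p) k * U k m)"
    unfolding infmat_mult_def
    by (rule sum.mono_neutral_left) (auto simp: L_entry[OF L p] split: if_splits)
  thus ?thesis using ne by (auto simp: L_entry[OF L p])
qed

lemma matrix_eq_iff:
  fixes A B :: infmat
  shows "A = B \<longleftrightarrow> (\<forall>j. \<forall>p<block_size \<nn> j. \<forall>m. A (\<nn> j + p) m = B (\<nn> j + p) m)"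
proof
  assume *: "\<forall>j. \<forall>p<block_size \<nn> j. \<forall>m. A (\<nn> j + p) m = B (\<nn> j + p) m"
  show "A = B"
  proof (intro ext)
    fix i m
    obtain j p where "p < block_size \<nn> j" "i = \<nn> j + p" by (rule block_cases)
    thus "A i m = B i m" using * by simp
  qed
qed simp

text \<open>The first conjunct compares \<open>J\<close> and \<open>LU\<close> in the second row of the \<open>j\<close>-th block, the other one in
  its first row; \<open>d\<close> is the upper-left entry of the \<open>j\<close>-th diagonal block of \<open>U\<close>.\<close>

definition LU_equations ::
    "(nat \<Rightarrow> real) \<Rightarrow> (nat \<Rightarrow> real) \<Rightarrow> (nat \<Rightarrow> real) \<Rightarrow> (nat \<Rightarrow> real) \<Rightarrow> (nat \<Rightarrow> real) \<Rightarrow> nat \<Rightarrow> bool" where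
  "LU_equations b c l u\<^sub>0 u\<^sub>1 j \<longleftrightarrow>
     (block_size \<nn> j = 2 \<longrightarrow> u\<^sub>0 j = c (\<nn> j) \<and> u\<^sub>1 j = b (\<nn> j + 1)) \<and>
     (let d = (if block_size \<nn> j = 2 then 0 else u\<^sub>0 j) in
      if j = 0 then b 0 = d
      else if block_size \<nn> (j - 1) = 2 then l j = c (\<nn> j - 1) \<and> b (\<nn> j) = d
      else l j * u\<^sub>0 (j - 1) = c (\<nn> j - 1) \<and> b (\<nn> j) = d + l j)"

lemma jacobi_eq_LU_iff:
  assumes L: "has_blocks \<nn> (L_block \<nn> l) L" and U: "has_blocks \<nn> (U_block \<nn> u\<^sub>0 u\<^sub>1) U"
  shows "monic_jacobi_matrix b c = infmat_mult L U \<longleftrightarrow> (\<forall>j. LU_equations b c l u\<^sub>0 u\<^sub>1 j)"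
proof -
  have "(\<forall>p<block_size \<nn> j. \<forall>m. monic_jacobi_matrix b c (\<nn> j + p) m = infmat_mult L U (\<nn> j + p) m)
      \<longleftrightarrow> LU_equations b c l u\<^sub>0 u\<^sub>1 j" for j
  proof -
    have s: "block_size \<nn> j = 1 \<or> block_size \<nn> j = 2" using size[of j] by auto
    define r0 where "r0 \<longleftrightarrow> (\<forall>m. monic_jacobi_matrix b c (\<nn> j) m = infmat_mult L U (\<nn> j) m)"
    define r1 where "r1 \<longleftrightarrow> (\<forall>m. monic_jacobi_matrix b c (\<nn> j + 1) m = infmat_mult L U (\<nn> j + 1) m)"
    define d where "d = (if block_size \<nn> j = 2 then 0 else u\<^sub>0 j)"
    have U0: "U (\<nn> j) m = (if m = \<nn> j + 1 then 1 else if m = \<nn> j then d else 0)" for m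
      using U_entry[OF U, of 0 j m] s by (auto simp: d_def)
    have r0: "r0 \<longleftrightarrow> (if j = 0 then b 0 = d
      else if block_size \<nn> (j - 1) = 2 then l j = c (\<nn> j - 1) \<and> b (\<nn> j) = d
      else l j * u\<^sub>0 (j - 1) = c (\<nn> j - 1) \<and> b (\<nn> j) = d + l j)"
    proof (cases "j = 0")
      case True
      have "infmat_mult L U 0 m = U 0 m" for m
        using LU_row[OF L, of 0 0 U m] size[of 0] by (auto simp: start)
      thus ?thesis using True U0 by (auto simp: r0_def start monic_jacobi_matrix_def)
    next
      case False
      define k where "k = \<nn> (j - 1)"
      have row: "infmat_mult L U (\<nn> j) m = (if m = \<nn> j + 1 then 1 else if m = \<nn> j then d else 0) + l j * U k m" for m
        using U0[of m] LU_row[OF L, of 0 j U m] s False by (auto simp: k_def)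
      have r0_iff: "r0 \<longleftrightarrow> (\<forall>m. monic_jacobi_matrix b c (\<nn> j) m =
          (if m = \<nn> j + 1 then 1 else if m = \<nn> j then d else 0) + l j * U k m)"
        by (simp only: r0_def row)
      have nj: "\<nn> j = k + block_size \<nn> (j - 1)" 
        using next_block[of "j - 1"] False by (simp add: k_def)
      have s': "block_size \<nn> (j - 1) = 1 \<or> block_size \<nn> (j - 1) = 2" using size[of "j - 1"] by auto
      have Uk: "U k m = (if m = k + 1 then 1 else if block_size \<nn> (j - 1) = 2 then 0 
          else if m = k then u\<^sub>0 (j - 1) else 0)" for m
        using U_entry[OF U, of 0 "j - 1" m] s' by (auto simp: k_def)
      from s' show ?thesis
      proof
        assume 1: "block_size \<nn> (j - 1) = 1"
        show ?thesis
        proof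
          assume r0
          hence "monic_jacobi_matrix b c (\<nn> j) m = (if m = \<nn> j + 1 then 1 else if m = \<nn> j then d else 0)
              + l j * U k m" for m
            unfolding r0_iff by blast
          from this[of k] this[of "k + 1"] show "if j = 0 then b 0 = d
              else if block_size \<nn> (j - 1) = 2 then l j = c (\<nn> j - 1) \<and> b (\<nn> j) = d
              else l j * u\<^sub>0 (j - 1) = c (\<nn> j - 1) \<and> b (\<nn> j) = d + l j"
            using False 1 nj by (simp add: Uk monic_jacobi_matrix_def)
        qed (use False 1 nj in \<open>auto simp: r0_iff Uk monic_jacobi_matrix_def\<close>)
      next
        assume 2: "block_size \<nn> (j - 1) = 2"
        show ?thesis
        proof
          assume r0
          hence "monic_jacobi_matrix b c (\<nn> j) m = (if m = \<nn> j + 1 then 1 else if m = \<nn> j then d else 0)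
              + l j * U k m" for m
            unfolding r0_iff by blast
          from this[of "k + 2"] this[of "k + 1"] show "if j = 0 then b 0 = d
              else if block_size \<nn> (j - 1) = 2 then l j = c (\<nn> j - 1) \<and> b (\<nn> j) = d
              else l j * u\<^sub>0 (j - 1) = c (\<nn> j - 1) \<and> b (\<nn> j) = d + l j"
            using False 2 nj by (simp add: Uk monic_jacobi_matrix_def)
        qed (use False 2 nj in \<open>auto simp: r0_iff Uk monic_jacobi_matrix_def\<close>)
      qed
    qed
    have r1: "r1 \<longleftrightarrow> u\<^sub>0 j = c (\<nn> j) \<and> u\<^sub>1 j = b (\<nn> j + 1)" if 2: "block_size \<nn> j = 2"
    proof -
      have "infmat_mult L U (\<nn> j + 1) m = (if m = \<nn> j + 2 then 1
          else if m = \<nn> j then u\<^sub>0 j else if m = \<nn> j + 1 then u\<^sub>1 j else 0)" for m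
        using LU_row[OF L, of 1 j U m] U_entry[OF U, of 1 j m] 2 by simp
      hence *: "r1 \<longleftrightarrow> (\<forall>m. monic_jacobi_matrix b c (\<nn> j + 1) m = (if m = \<nn> j + 2 then 1
          else if m = \<nn> j then u\<^sub>0 j else if m = \<nn> j + 1 then u\<^sub>1 j else 0))" (is "_ = (\<forall>m. ?Q m)")
        by (simp only: r1_def)
      show ?thesis
      proof
        assume r1
        hence "?Q (\<nn> j)" "?Q (\<nn> j + 1)" using * by blast+
        thus "u\<^sub>0 j = c (\<nn> j) \<and> u\<^sub>1 j = b (\<nn> j + 1)" by (simp add: monic_jacobi_matrix_def)
      qed (auto simp: * monic_jacobi_matrix_def)
    qed
    have "(\<forall>p<block_size \<nn> j. \<forall>m. monic_jacobi_matrix b c (\<nn> j + p) m = infmat_mult L U (\<nn> j + p) m)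
      \<longleftrightarrow> r0 \<and> (block_size \<nn> j = 2 \<longrightarrow> r1)"
      using s by (auto simp: r0_def r1_def less_2_cases_iff)
    thus ?thesis using r0 r1 unfolding LU_equations_def d_def Let_def by auto
  qed
  thus ?thesis unfolding matrix_eq_iff by simp
qed

lemma LU_factorization_iff:
  "LU_factorization \<nn> (monic_jacobi_matrix b c) l u\<^sub>0 u\<^sub>1 L U \<longleftrightarrow>
    has_blocks \<nn> (L_block \<nn> l) L \<and> has_blocks \<nn> (U_block \<nn> u\<^sub>0 u\<^sub>1) U \<and>
    (\<forall>j. LU_equations b c l u\<^sub>0 u\<^sub>1 j)"
  unfolding LU_factorization_def using jacobi_eq_LU_iff by blast

lemma LU_equations_unique:
  assumes c: "\<And>j. c j > 0"
    and eq: "\<And>j. LU_equations b c l u\<^sub>0 u\<^sub>1 j" and eq': "\<And>j. LU_equations b c l' u\<^sub>0' u\<^sub>1' j"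
  shows "u\<^sub>0 j = u\<^sub>0' j \<and> (block_size \<nn> j = 2 \<longrightarrow> u\<^sub>1 j = u\<^sub>1' j) \<and> (0 < j \<longrightarrow> l j = l' j)"
proof (induction j)
  case 0
  show ?case using eq[of 0] eq'[of 0] by (auto simp: LU_equations_def Let_def split: if_splits)
next
  case (Suc j)
  have "l (Suc j) = l' (Suc j)"
  proof (cases "block_size \<nn> j = 2")
    case True
    thus ?thesis using eq[of "Suc j"] eq'[of "Suc j"] by (simp add: LU_equations_def Let_def)
  next
    case False
    hence *: "l (Suc j) * u\<^sub>0 j = c (\<nn> (Suc j) - 1)" "l' (Suc j) * u\<^sub>0' j = c (\<nn> (Suc j) - 1)"
      using eq[of "Suc j"] eq'[of "Suc j"] by (simp_all add: LU_equations_def Let_def)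
    moreover have "u\<^sub>0 j \<noteq> 0" using *(1) c[of "\<nn> (Suc j) - 1"] by auto
    ultimately show ?thesis using Suc.IH by (metis mult_right_cancel)
  qed
  thus ?case using eq[of "Suc j"] eq'[of "Suc j"]
    by (auto simp: LU_equations_def Let_def split: if_splits)
qed

lemma LU_factorization_unique:
  assumes "\<And>j. c j > 0"
    and f: "LU_factorization \<nn> (monic_jacobi_matrix b c) l u\<^sub>0 u\<^sub>1 L U"
    and f': "LU_factorization \<nn> (monic_jacobi_matrix b c) l' u\<^sub>0' u\<^sub>1' L' U'"
  shows "L' = L \<and> U' = U"
proof -
  have e: "u\<^sub>0' j = u\<^sub>0 j" "block_size \<nn> j = 2 \<Longrightarrow> u\<^sub>1' j = u\<^sub>1 j" "0 < j \<Longrightarrow> l' j = l j" for j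
    using LU_equations_unique[where c = c and b = b and l = l' and u\<^sub>0 = u\<^sub>0' and u\<^sub>1 = u\<^sub>1'
        and l' = l and u\<^sub>0' = u\<^sub>0 and u\<^sub>1' = u\<^sub>1 and j = j] assms(1) f f'
    unfolding LU_factorization_iff by blast+
  have "L_block \<nn> l' = L_block \<nn> l"
    by (intro ext) (simp add: L_block_def e cong: if_cong)
  moreover have "U_block \<nn> u\<^sub>0' u\<^sub>1' = U_block \<nn> u\<^sub>0 u\<^sub>1"
  proof (intro ext)
    show "U_block \<nn> u\<^sub>0' u\<^sub>1' i j = U_block \<nn> u\<^sub>0 u\<^sub>1 i j" for i j
      using e(2)[of j] size[of j] by (auto simp: U_block_def e(1))
  qed
  ultimately show ?thesis using f f' unfolding LU_factorization_iff
    by (metis has_blocks_unique)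
qed

end

lemma normal_index_enumerates:
  assumes "infinite (normal_indices s)"
  shows "range (normal_index s) = insert 0 (normal_indices s)" "strict_mono (normal_index s)"
proof -
  have "range (normal_index s) = insert (normal_index s 0) (range (\<lambda>j. normal_index s (Suc j)))"
    by (auto simp: image_iff) (metis not0_implies_Suc)
  thus "range (normal_index s) = insert 0 (normal_indices s)"
    using range_enumerate[OF assms] by (simp add: normal_index_def)
  show "strict_mono (normal_index s)"
    unfolding strict_mono_Suc_iff
  proof
    fix j
    have "Infinite_Set.enumerate (normal_indices s) 0 \<in> normal_indices s"
      by (rule enumerate_in_set[OF assms])
    hence "0 < Infinite_Set.enumerate (normal_indices s) 0" by (simp add: normal_indices_def)
    thus "normal_index s j < normal_index s (Suc j)"
      using enumerate_step[OF assms] by (cases j) (simp_all add: normal_index_def)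
  qed
qed

lemma block_partition_of_gaps:
  assumes n: "\<nn> 0 = 0" "strict_mono \<nn>" "range \<nn> = S"
    and gaps: "\<And>n. n \<in> S \<or> Suc n \<in> S"
  shows "block_partition \<nn>"
proof
  fix j
  obtain m where m: "m \<in> {\<nn> j + 1, \<nn> j + 2}" "m \<in> S" using gaps[of "\<nn> j + 1"] by auto
  then obtain i where i: "m = \<nn> i" using n(3) by auto
  have "\<nn> j < \<nn> i" using m i by auto
  hence "\<nn> (Suc j) \<le> \<nn> i" using n(2) by (simp add: strict_mono_less strict_mono_less_eq Suc_le_eq)
  moreover have "\<nn> j < \<nn> (Suc j)" using n(2) by (simp add: strict_mono_less)
  ultimately show "block_size \<nn> j \<in> {1, 2}" using m i by (auto simp: block_size_def)
qed (rule n(1))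

lemma infinite_of_gaps:
  assumes "\<And>n::nat. n \<in> S \<or> Suc n \<in> S"
  shows "infinite S"
  unfolding infinite_nat_iff_unbounded_le using assms by (meson le_Suc_eq order_refl)

lemma (in block_partition) LU_equations_solution:
  fixes p b c :: "nat \<Rightarrow> real"
  assumes rec0: "p 1 + b 0 * p 0 = 0"
    and rec: "\<And>n. p (n + 2) + b (n + 1) * p (n + 1) + c n * p n = 0"
    and zero: "\<And>n. p n \<noteq> 0 \<longleftrightarrow> n \<in> range \<nn>"
  shows "LU_equations b c
      (\<lambda>j. if block_size \<nn> (j - 1) = 2 then c (\<nn> j - 1) else - c (\<nn> j - 1) * p (\<nn> j - 1) / p (\<nn> j))
      (\<lambda>j. - (p (\<nn> (j + 1)) / p (\<nn> j))) (\<lambda>j. b (\<nn> j + 1)) j"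
proof -
  have nz: "p (\<nn> i) \<noteq> 0" for i using zero by blast
  have mid: "p (\<nn> i + 1) = 0" if "block_size \<nn> i = 2" for i
  proof (rule ccontr)
    assume "p (\<nn> i + 1) \<noteq> 0"
    then obtain k where "\<nn> i + 1 = \<nn> k" using zero by auto
    moreover have "\<nn> (Suc i) = \<nn> i + 2" using next_block[of i] that by simp
    ultimately have "\<nn> i < \<nn> k" "\<nn> k < \<nn> (Suc i)" by linarith+
    thus False unfolding less_iff by simp
  qed
  define d where "d = (if block_size \<nn> j = 2 then 0 else - (p (\<nn> (j + 1)) / p (\<nn> j)))"
  have d: "d = - p (\<nn> j + 1) / p (\<nn> j)"
    using mid[of j] next_block[of j] size[of j] by (auto simp: d_def)
  have two: "- (p (\<nn> (j + 1)) / p (\<nn> j)) = c (\<nn> j)" if "block_size \<nn> j = 2"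
  proof -
    have "p (\<nn> j + 2) + c (\<nn> j) * p (\<nn> j) = 0" using rec[of "\<nn> j"] mid[OF that] by simp
    moreover have "\<nn> (j + 1) = \<nn> j + 2" using next_block[of j] that by simp
    ultimately show ?thesis using nz[of j] by (simp add: field_simps)
  qed
  show ?thesis
  proof (cases j)
    case 0
    hence "b 0 = d" using rec0 nz[of 0] unfolding d by (simp add: start field_simps)
    thus ?thesis using two 0 unfolding LU_equations_def d_def[symmetric] by simp
  next
    case (Suc i)
    have nj: "\<nn> j = \<nn> i + block_size \<nn> i" using next_block[of i] Suc by simp
    have "\<nn> j > 0" using nj size[of i] by auto
    then obtain n where n: "\<nn> j = n + 1" by (metis Suc_eq_plus1 gr0_conv_Suc)
    have r: "p (\<nn> j + 1) + b (\<nn> j) * p (\<nn> j) + c (\<nn> j - 1) * p (\<nn> j - 1) = 0"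
      using rec[of n] n by simp
    show ?thesis
    proof (cases "block_size \<nn> i = 2")
      case True
      have "p (\<nn> j - 1) = 0" using mid[OF True] nj True by simp
      hence "b (\<nn> j) = d" using r nz[of j] unfolding d by (simp add: field_simps)
      thus ?thesis using two Suc True unfolding LU_equations_def d_def[symmetric] by simp
    next
      case False
      hence i: "\<nn> i = \<nn> j - 1" using nj size[of i] by auto
      have "b (\<nn> j) = d + - c (\<nn> j - 1) * p (\<nn> j - 1) / p (\<nn> j)"
        using r nz[of j] unfolding d by (simp add: field_simps)
      moreover have "- c (\<nn> j - 1) * p (\<nn> j - 1) / p (\<nn> j) * - (p (\<nn> j) / p (\<nn> i)) = c (\<nn> j - 1)"
        using nz[of i] nz[of j] unfolding i by simp
      ultimately show ?thesis using two Suc False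
        unfolding LU_equations_def d_def[symmetric] by simp
    qed
  qed
qed

section \<open>The factorization along the normal indices\<close>

lemma moment_functional_definite:
  fixes \<sigma> :: "real measure"
  assumes "sets \<sigma> = sets borel" "\<And>j. integrable \<sigma> (\<lambda>t. t ^ j)" "infinite (measure_support \<sigma>)"
  shows "definite_functional (\<lambda>p. \<integral>t. poly p t \<partial>\<sigma>)"
proof
  note int = integrable_poly[of \<sigma>, OF assms(2)]
  fix p q :: "real poly" and a :: real
  show "(\<integral>t. poly (p + q) t \<partial>\<sigma>) = (\<integral>t. poly p t \<partial>\<sigma>) + (\<integral>t. poly q t \<partial>\<sigma>)"
    by (simp add: int)
  show "(\<integral>t. poly (Polynomial.smult a p) t \<partial>\<sigma>) = a * (\<integral>t. poly p t \<partial>\<sigma>)"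
    by simp
  show "p = 0" if "(\<integral>t. poly (p * p) t \<partial>\<sigma>) = 0"
    by (rule infinite_support_imp_poly_eq_0[OF assms(1) int assms(3) that])
qed

lemma jacobi_recurrence_at_0:
  assumes "jacobi_recurrence P b c"
  shows "poly (P 1) 0 + b 0 * poly (P 0) 0 = 0"
    and "poly (P (n + 2)) 0 + b (n + 1) * poly (P (n + 1)) 0 + c n * poly (P n) 0 = 0"
proof -
  have *: "[:0, 1:] * P j = P (j + 1) + Polynomial.smult (b j) (P j) +
            (if j = 0 then 0 else Polynomial.smult (c (j - 1)) (P (j - 1)))" for j
    using assms by (simp only: jacobi_recurrence_def)
  from arg_cong[OF *[of 0], of "\<lambda>q. poly q 0"] show "poly (P 1) 0 + b 0 * poly (P 0) 0 = 0"
    by simp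
  from arg_cong[OF *[of "n + 1"], of "\<lambda>q. poly q 0"]
  show "poly (P (n + 2)) 0 + b (n + 1) * poly (P (n + 1)) 0 + c n * poly (P n) 0 = 0"
    by simp
qed

lemma no_consecutive_zeros:
  fixes p b c :: "nat \<Rightarrow> real"
  assumes "p 0 \<noteq> 0" and c: "\<And>n. c n \<noteq> 0"
    and rec: "\<And>n. p (n + 2) + b (n + 1) * p (n + 1) + c n * p n = 0"
  shows "p n \<noteq> 0 \<or> p (Suc n) \<noteq> 0"
proof (induction n)
  case (Suc n)
  have "p (Suc (Suc n)) \<noteq> 0" if "p (Suc n) = 0"
    using rec[of n] c[of n] Suc.IH that by auto
  thus ?case by blast
qed (use assms(1) in simp)

lemma normal_indices_shifted_moments:
  fixes \<sigma> :: "real measure"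
  assumes sets: "sets \<sigma> = sets borel" and int: "\<And>j. integrable \<sigma> (\<lambda>t. t ^ j)"
    and supp: "infinite (measure_support \<sigma>)"
    and mom: "\<And>j. s j = (\<integral>t. t ^ j \<partial>\<sigma>)"
    and P: "monic_orthogonal_polys (scale_measure (ennreal (1 / s 0)) \<sigma>) P"
  shows "normal_indices (\<lambda>j. s (j + 1)) = {n. n \<ge> 1 \<and> poly (P n) 0 \<noteq> 0}"
proof -
  interpret definite_functional "\<lambda>p. \<integral>t. poly p t \<partial>\<sigma>"
    using sets int supp by (rule moment_functional_definite)
  have s0: "s 0 > 0"
    using definite[of 1] by (auto simp: mom zero_less_measure_iff)
  have P': "degree (P j) = j" "lead_coeff (P j) = 1" for j
    using P unfolding monic_orthogonal_polys_def by blast+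
  have "(\<integral>t. poly (P i * P j) t \<partial>\<sigma>) = 0" if "i \<noteq> j" for i j
  proof -
    have "0 = (\<integral>t. poly (P i * P j) t \<partial>(scale_measure (ennreal (1 / s 0)) \<sigma>))"
      using P that by (simp add: monic_orthogonal_polys_def)
    also have "\<dots> = (1 / s 0) * (\<integral>t. poly (P i * P j) t \<partial>\<sigma>)"
      using s0 by (intro integral_scale_measure borel_measurable_integrable integrable_poly int) simp
    finally show ?thesis using s0 by simp
  qed
  note H = shifted_hankel_det_eq_0_iff[of P, OF P' this]
  have "Determinant.det (Matrix.mat n n (\<lambda>(i, k). s (i + k + 1))) = 0 \<longleftrightarrow> poly (P n) 0 = 0" if "n \<ge> 1" for n
    using H[of n] that by (simp add: mom poly_monom)
  thus ?thesis by (auto simp: normal_indices_def)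
qed

theorem proposition3p1:
  fixes F :: "complex \<Rightarrow> complex" and s b c \<ss> :: "nat \<Rightarrow> real"
    and \<sigma> :: "real measure" and P :: "nat \<Rightarrow> real poly"
    and J :: infmat and \<nn> \<kk> :: "nat \<Rightarrow> nat"
  assumes "F \<in> nevanlinna_minus_infinity"
    and "asymptotic_coeffs F s"
    and "representing_measure F \<sigma>"
    and "infinite (measure_support \<sigma>)"
    and "monic_orthogonal_polys (scale_measure (ennreal (1 / s 0)) \<sigma>) P"
    and "jacobi_recurrence P b c"
    and "J = monic_jacobi_matrix b c"
    and "\<ss> = (\<lambda>j. s (j + 1))"
    and "\<nn> = normal_index \<ss>"
    and "\<kk> = block_size \<nn>"
  shows "infinite (normal_indices \<ss>) \<and> (\<forall>j. \<kk> j \<in> {1, 2}) \<and>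
    (\<forall>j. poly (P (\<nn> j)) 0 \<noteq> 0) \<and>
    (\<exists>l u\<^sub>0 u\<^sub>1 L U.
       LU_factorization \<nn> J l u\<^sub>0 u\<^sub>1 L U \<and>
       (\<forall>l' u\<^sub>0' u\<^sub>1' L' U'. LU_factorization \<nn> J l' u\<^sub>0' u\<^sub>1' L' U' \<longrightarrow> L' = L \<and> U' = U) \<and>
       (\<forall>j. u\<^sub>0 j = - (poly (P (\<nn> (j + 1))) 0 / poly (P (\<nn> j)) 0)) \<and>
       (\<forall>j. \<kk> j = 2 \<longrightarrow> u\<^sub>1 j = b (\<nn> j + 1)))"
proof -
  define p where "p n = poly (P n) 0" for n
  have c: "c n > 0" for n using assms(6) by (simp add: jacobi_recurrence_def)
  note rec = jacobi_recurrence_at_0[OF assms(6), folded p_def]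
  have p0: "p 0 \<noteq> 0"
  proof -
    have "degree (P 0) = 0 \<and> lead_coeff (P 0) = 1"
      using assms(5) unfolding monic_orthogonal_polys_def by blast
    hence "coeff (P 0) 0 = 1" by metis
    thus ?thesis by (simp add: p_def poly_0_coeff_0)
  qed
  have N: "normal_indices \<ss> = {n. n \<ge> 1 \<and> p n \<noteq> 0}"
    unfolding assms(8) p_def
    by (rule normal_indices_shifted_moments[OF _ _ assms(4) asymptotic_coeffs_eq_moments[OF assms(2,3)] assms(5)])
      (use assms(3) in \<open>simp_all add: representing_measure_def\<close>)
  have gaps: "n \<in> {n. p n \<noteq> 0} \<or> Suc n \<in> {n. p n \<noteq> 0}" for n
    using no_consecutive_zeros[of p c b n] p0 c rec(2) by (simp add: less_imp_neq[symmetric])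
  have ins: "insert 0 (normal_indices \<ss>) = {n. p n \<noteq> 0}"
    using p0 by (auto simp: N Suc_le_eq intro: gr0I)
  hence inf: "infinite (normal_indices \<ss>)"
    using infinite_of_gaps[OF gaps] by (metis finite_insert)
  have ran: "range \<nn> = {n. p n \<noteq> 0}"
    using normal_index_enumerates(1)[OF inf] ins assms(9) by simp
  interpret block_partition \<nn>
    using ran normal_index_enumerates(2)[OF inf] gaps
    by (intro block_partition_of_gaps[of _ "{n. p n \<noteq> 0}"]) (auto simp: assms(9) normal_index_def)
  obtain l where eq: "\<And>j. LU_equations b c l
      (\<lambda>j. - (p (\<nn> (j + 1)) / p (\<nn> j))) (\<lambda>j. b (\<nn> j + 1)) j"
    using LU_equations_solution[of p b c] rec ran by blast
  obtain L where L: "has_blocks \<nn> (L_block \<nn> l) L"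
    using has_blocks_exists[of "L_block \<nn> l"] L_block_carrier by blast
  obtain U where U: "has_blocks \<nn> (U_block \<nn> (\<lambda>j. - (p (\<nn> (j + 1)) / p (\<nn> j))) (\<lambda>j. b (\<nn> j + 1))) U"
    using has_blocks_exists[of "U_block \<nn> (\<lambda>j. - (p (\<nn> (j + 1)) / p (\<nn> j))) (\<lambda>j. b (\<nn> j + 1))"]
      U_block_carrier by blast
  have LU: "LU_factorization \<nn> J l (\<lambda>j. - (p (\<nn> (j + 1)) / p (\<nn> j))) (\<lambda>j. b (\<nn> j + 1)) L U"
    using L U eq unfolding assms(7) LU_factorization_iff by blast
  show ?thesis
  proof (intro conjI)
    show "\<forall>j. \<kk> j \<in> {1, 2}" using size assms(10) by simp
    show "\<forall>j. poly (P (\<nn> j)) 0 \<noteq> 0" using ran by (auto simp: p_def)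
    show "\<exists>l u\<^sub>0 u\<^sub>1 L U.
       LU_factorization \<nn> J l u\<^sub>0 u\<^sub>1 L U \<and>
       (\<forall>l' u\<^sub>0' u\<^sub>1' L' U'. LU_factorization \<nn> J l' u\<^sub>0' u\<^sub>1' L' U' \<longrightarrow> L' = L \<and> U' = U) \<and>
       (\<forall>j. u\<^sub>0 j = - (poly (P (\<nn> (j + 1))) 0 / poly (P (\<nn> j)) 0)) \<and>
       (\<forall>j. \<kk> j = 2 \<longrightarrow> u\<^sub>1 j = b (\<nn> j + 1))"
      using LU LU_factorization_unique[OF c LU[unfolded assms(7)]]
      unfolding assms(7) p_def by blast
  qed (rule inf)
qed

end
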